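(* Let $k\ge 1$ and let $\lambda_1,\ldots,\lambda_k$ be integers with $\gcd(\lambda_1,\ldots,\lambda_k)=1$. Then there is a constant $C\ge 0$, depending only on $\lambda_1,\ldots,\lambda_k$, such that for every finite set $A\subset\mathbb{Z}$, $$|\lambda_1\cdot A+\cdots+\lambda_k\cdot A|\ \ge\ (|\lambda_1|+\cdots+|\lambda_k|)\,|A|-C.$$
   Context: For a real number $d$ and a finite set $A$, $d\cdot A=\{da: a\in A\}$. For finite sets $B_1,\dots,B_k$, $B_1+\cdots+B_k=\{b_1+\cdots+b_k: b_i\in B_i\}$. $|X|$ denotes the cardinality of a finite set $X$. *)

theory Defs
  imports Complex_Main
begin

definition dilate :: "int \<Rightarrow> int set \<Rightarrow> int set" where
  "dilate d A = (\<lambda>a. d * a) ` A"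

fun sumset_list :: "int set list \<Rightarrow> int set" where
  "sumset_list [] = {0}"
| "sumset_list (B # Bs) = {b + c | b c. b \<in> B \<and> c \<in> sumset_list Bs}"

end

theory Submission
  imports Defs "HOL-Library.Set_Algebras" "HOL-Number_Theory.Cong"
begin

text \<open>
  Write \<open>M(A)\<close> for the sum of the dilates of \<open>A\<close> by the members of a list \<open>M\<close>. If \<open>A\<close> meets every
  residue class modulo the relevant coefficients, splitting all sets into residue classes gives the
  bound at once. The idea is therefore to show that sets missing a class do better than expected.

  Two bounds are proved in this way. The relative one says that adding \<open>q \<cdot> A\<close> to any set \<open>Z\<close> which
  contains a translate of \<open>M(A)\<close>, where \<open>M\<close> and \<open>q\<close> are jointly coprime, enlarges \<open>Z\<close> by at least
  \<open>\<bar>q\<bar> |A| - C\<close>. Since \<open>Z\<close> may be arbitrarily large, only its supply of residue classes matters.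
  The absolute one is the theorem, by induction on the number of dilates: peel off one
  coefficient \<open>q\<close>, let \<open>g\<close> be the gcd of the others, and split modulo \<open>g\<close>.

  In both cases the bound with a slope \<open>m\<close> is improved to slope \<open>m + \<delta>\<close>, for a fixed \<open>\<delta>\<close>, at the cost
  of a larger constant; finitely many steps reach the full slope. Splitting \<open>A\<close> into residue
  classes preserves slope \<open>m\<close>, and a class of \<open>A\<close> that is itself missing a residue class forces an
  additional class in the sumset, hence a gain proportional to \<open>|A|\<close>.
\<close>

section \<open>Residue classes and bootstrapping the slope\<close>

text \<open>\<open>K m C\<close> stands for a lower bound with slope \<open>m\<close> and constant
  \<open>C\<close>. The increment \<open>\<epsilon>\<close> does not depend on \<open>m\<close> or
  \<open>C\<close>, so finitely many steps, each free to worsen the constant, reach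
  \<open>S\<close>.\<close>

lemma slope_improvement:
  fixes K :: "real \<Rightarrow> real \<Rightarrow> bool"
  assumes "\<epsilon> > 0" and "S \<ge> 0" and "K 0 C"
    and step: "\<And>m C. 0 \<le> m \<Longrightarrow> m \<le> S \<Longrightarrow> K m C \<Longrightarrow> \<exists>C'. K (min S (m + \<epsilon>)) C'"
  shows "\<exists>C. K S C"
proof -
  have "\<exists>C. K (min S (real n * \<epsilon>)) C" for n
  proof (induction n)
    case 0
    then show ?case using assms by (auto simp: min_def)
  next
    case (Suc n)
    then obtain C where "K (min S (real n * \<epsilon>)) C" by blast
    moreover have "0 \<le> min S (real n * \<epsilon>)" "min S (real n * \<epsilon>) \<le> S"
      using assms by auto
    ultimately obtain C' where "K (min S (min S (real n * \<epsilon>) + \<epsilon>)) C'"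
      using step by blast
    moreover have "min S (min S (real n * \<epsilon>) + \<epsilon>) = min S (real (Suc n) * \<epsilon>)"
      using \<open>\<epsilon> > 0\<close> by (auto simp: min_def algebra_simps)
    ultimately show ?case by metis
  qed
  moreover obtain n where "S \<le> real n * \<epsilon>"
    using \<open>\<epsilon> > 0\<close> by (metis reals_Archimedean3 less_imp_le)
  ultimately show ?thesis by (metis min.absorb1)
qed

section \<open>Rescaled residue classes\<close>

definition part :: "int \<Rightarrow> int \<Rightarrow> int set \<Rightarrow> int set" where
  "part N s A = {x. N * x + s \<in> A}"

definition residue_set :: "int \<Rightarrow> int set \<Rightarrow> int set" where
  "residue_set N A = {s \<in> {0..<N}. part N s A \<noteq> {}}"

lemma finite_res [simp]: "finite (residue_set N A)"
  unfolding residue_set_def by (rule finite_subset[of _ "{0..<N}"]) auto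

lemma residue_set_iff: "N > 0 \<Longrightarrow> s \<in> residue_set N A \<longleftrightarrow> (\<exists>a\<in>A. a mod N = s)"
proof
  assume "N > 0" "s \<in> residue_set N A"
  then obtain x where "N * x + s \<in> A" "0 \<le> s" "s < N" by (auto simp: residue_set_def part_def)
  then show "\<exists>a\<in>A. a mod N = s" by (intro bexI[of _ "N * x + s"]) auto
next
  assume "N > 0" "\<exists>a\<in>A. a mod N = s"
  then obtain a where a: "a \<in> A" "a mod N = s" by blast
  then have "a div N \<in> part N s A" unfolding part_def by (auto simp: mult_div_mod_eq)
  then show "s \<in> residue_set N A" using a \<open>N > 0\<close> unfolding residue_set_def by auto
qed

lemma finite_part [simp]: "N > 0 \<Longrightarrow> finite A \<Longrightarrow> finite (part N s A)"
proof -
  assume "N > 0" "finite A"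
  moreover have "part N s A = (\<lambda>x. N * x + s) -` A" by (auto simp: part_def)
  ultimately show ?thesis by (auto intro!: finite_vimageI injI)
qed

lemma card_part_class:
  assumes "N > 0"
  shows "card (part N s A) = card {a \<in> A. [a = s] (mod N)}"
proof -
  have "{a \<in> A. [a = s] (mod N)} = (\<lambda>x. N * x + s) ` part N s A"
  proof (intro equalityI subsetI)
    fix a assume "a \<in> {a \<in> A. [a = s] (mod N)}"
    then have a: "a \<in> A" "[s = a] (mod N)" by (auto simp: cong_sym)
    then obtain k where "a = s + N * k" by (auto simp: cong_iff_lin mult.commute)
    with a show "a \<in> (\<lambda>x. N * x + s) ` part N s A"
      by (auto simp: part_def algebra_simps image_iff)
  qed (auto simp: part_def cong_def)
  moreover have "inj_on (\<lambda>x. N * x + s) (part N s A)" using assms by (auto intro: inj_onI)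
  ultimately show ?thesis by (simp add: card_image)
qed

lemma card_eq_sum_part_all:
  assumes "N > 0" "finite A"
  shows "card A = (\<Sum>s\<in>{0..<N}. card (part N s A))"
proof -
  have "A = (\<Union>s\<in>{0..<N}. {a \<in> A. [a = s] (mod N)})"
    using assms by (auto simp: cong_def intro!: bexI[of _ "_ mod N"])
  then have "card A = card (\<Union>s\<in>{0..<N}. {a \<in> A. [a = s] (mod N)})" by simp
  also have "\<dots> = (\<Sum>s\<in>{0..<N}. card {a \<in> A. [a = s] (mod N)})"
    using assms by (subst card_UN_disjoint) (auto simp: cong_def)
  finally show ?thesis using card_part_class[OF assms(1)] by simp
qed

lemma card_eq_sum_part:
  assumes "N > 0" "finite A"
  shows "card A = (\<Sum>s\<in>residue_set N A. card (part N s A))"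
  unfolding card_eq_sum_part_all[OF assms]
  by (rule sum.mono_neutral_right) (auto simp: residue_set_def)

lemma part_single_class:
  assumes "g > 0" "\<forall>a\<in>A. a mod g = s"
  shows "A = (\<lambda>x. g * x + s) ` part g s A"
proof (intro equalityI subsetI)
  fix a assume "a \<in> A"
  then have "a = g * (a div g) + s" using assms(2) by (metis mult_div_mod_eq)
  then show "a \<in> (\<lambda>x. g * x + s) ` part g s A" using \<open>a \<in> A\<close>
    by (metis (mono_tags, lifting) imageI mem_Collect_eq part_def)
qed (auto simp: part_def)

lemma card_le_1_of_dist_0: "\<forall>a\<in>A. \<forall>b\<in>A. \<bar>a - b\<bar> \<le> (0::int) \<Longrightarrow> card A \<le> 1"
  by (cases "finite A") (auto simp: card_le_Suc0_iff_eq)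

text \<open>For nonempty \<open>A\<close>: \<open>N\<close> and the differences of elements of
  \<open>A\<close> have no common factor above 1. A nonempty set violating this can be shrunk by
  \<open>part\<close> to one of equal size and at most half the diameter.\<close>

definition primitive :: "int \<Rightarrow> int set \<Rightarrow> bool" where
  "primitive N A \<longleftrightarrow> \<not> (\<exists>g s. g > 1 \<and> g dvd N \<and> (\<forall>a\<in>A. a mod g = s))"

text \<open>
  \<open>R A v\<close> is to be read as: \<open>v\<close> is a possible size of a sumset built from \<open>A\<close>. The value \<open>f s\<close> is the
  share contributed by class \<open>s\<close>. The bound \<open>card A - 1\<close> makes very small classes of \<open>A\<close> profitable; the
  last two alternatives describe a class of the sumset that is not accounted for by class \<open>s\<close>, or
  by the subclasses of class \<open>s\<close>, alone.
\<close>

definition splits_with_gain :: "(int set \<Rightarrow> real \<Rightarrow> bool) \<Rightarrow> int \<Rightarrow> int set \<Rightarrow> real \<Rightarrow> bool" where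
  "splits_with_gain R N A v \<longleftrightarrow> (\<exists>f :: int \<Rightarrow> real. sum f (residue_set N A) \<le> v \<and>
     (\<forall>s\<in>residue_set N A. f s \<ge> real (card A) - 1 \<and>
       (\<exists>w::real. w \<le> f s \<and> R (part N s A) w \<and>
         (residue_set N (part N s A) = {0..<N} \<or>
          (\<exists>t\<in>residue_set N A. f s \<ge> w + card (part N t A)) \<or>
          (\<exists>u :: int \<Rightarrow> real. f s \<ge> sum u (residue_set N (part N s A)) + card (part N s A) - 1 \<and>
             (\<forall>t\<in>residue_set N (part N s A). R (part N t (part N s A)) (u t)))))))"

text \<open>Summing old bounds over the classes loses only constants, so improving one class by a
  fixed proportion of \<open>card A\<close> raises the slope. \<open>full\<close> gives the target
  slope outright, \<open>split\<close> gives the improvement, and \<open>single\<close> reduces to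
  primitive sets.\<close>

lemma linear_bound_bootstrap:
  fixes R :: "int set \<Rightarrow> real \<Rightarrow> bool" and N :: int and S C0 :: real
  assumes N: "N > 0" and S: "S \<ge> 1" and C0: "C0 \<ge> 0"
    and nonneg: "\<And>A v. R A v \<Longrightarrow> finite A \<Longrightarrow> v \<ge> 0"
    and full: "\<And>A v. R A v \<Longrightarrow> finite A \<Longrightarrow> residue_set N A = {0..<N} \<Longrightarrow> v \<ge> S * card A - C0"
    and single: "\<And>A v g s. R A v \<Longrightarrow> finite A \<Longrightarrow> g > 1 \<Longrightarrow> g dvd N \<Longrightarrow> \<forall>a\<in>A. a mod g = s
        \<Longrightarrow> \<exists>w\<le>v. R (part g s A) w"
    and split: "\<And>A v. R A v \<Longrightarrow> finite A \<Longrightarrow> primitive N A \<Longrightarrow>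
        splits_with_gain R N A v"
  shows "\<exists>C\<ge>0. \<forall>A v. finite A \<longrightarrow> R A v \<longrightarrow> v \<ge> S * card A - C"
proof -
  \<comment> \<open>\<open>\<delta>\<close> is both the gain in slope and the threshold for a small
    class. Since \<open>S * \<delta> = 1/2\<close> and \<open>\<delta> \<le> 1/2\<close>, the bound
    \<open>card A - 1\<close> already yields the gain at a small class.\<close>
  define \<delta> where "\<delta> = 1 / (2 * S)"
  have d: "\<delta> > 0" "\<delta> \<le> 1/2" "S * \<delta> = 1/2" using S by (auto simp: \<delta>_def field_simps)
  define K where "K m C \<longleftrightarrow> C \<ge> 0 \<and> (\<forall>A v. finite A \<longrightarrow> R A v \<longrightarrow> v \<ge> m * card A - C)" for m C :: real
  have "\<exists>C. K S C"
  proof (rule slope_improvement[of \<delta> S K 0])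
    show "K 0 0" using nonneg by (auto simp: K_def)
  next
    fix m C assume m: "0 \<le> m" "m \<le> S" and KC: "K m C"
    have C: "C \<ge> 0" and IH: "\<And>A v. finite A \<Longrightarrow> R A v \<Longrightarrow> v \<ge> m * card A - C"
      using KC by (auto simp: K_def)
    define m' where "m' = min S (m + \<delta>)"
    \<comment> \<open>Large enough for all cases: \<open>N * C + 1\<close> for a small class,
      \<open>N * C0\<close> if all classes are full, \<open>2 * N * C + 1\<close> if one is not, and
      \<open>S\<close> for sets with at most one element.\<close>
    define C' where "C' = 2 * N * C + N * C0 + S + 1"
    have NC: "N * C \<ge> C" "N * C0 \<ge> C0"
      using N C C0 by (auto intro: order_trans[OF _ mult_right_mono[of 1 "real_of_int N"]])
    have m': "0 \<le> m'" "m' \<le> S" "m' \<le> m + \<delta>" using m d by (auto simp: m'_def)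
    have prim: "v \<ge> m' * card A - C'" if A: "finite A" "R A v" "primitive N A" for A v
    proof -
      obtain f :: "int \<Rightarrow> real" where fv: "sum f (residue_set N A) \<le> v"
        and f1: "\<And>s. s \<in> residue_set N A \<Longrightarrow> f s \<ge> real (card A) - 1"
        and f2: "\<And>s. s \<in> residue_set N A \<Longrightarrow> \<exists>w::real. w \<le> f s \<and> R (part N s A) w \<and>
            (residue_set N (part N s A) = {0..<N} \<or>
             (\<exists>t\<in>residue_set N A. f s \<ge> w + card (part N t A)) \<or>
             (\<exists>u :: int \<Rightarrow> real. f s \<ge> sum u (residue_set N (part N s A)) + card (part N s A) - 1 \<and>
                (\<forall>t\<in>residue_set N (part N s A). R (part N t (part N s A)) (u t))))"
        using split[OF A(2,1,3)] unfolding splits_with_gain_def by blast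
      define n where "n s = real (card (part N s A))" for s
      have nsum: "real (card A) = sum n (residue_set N A)"
        unfolding n_def using card_eq_sum_part[OF N A(1)] by (metis of_nat_sum)
      have n_le: "n s \<le> card A" if "s \<in> residue_set N A" for s
        unfolding nsum using that by (intro member_le_sum) (auto simp: n_def)
      have card_res: "real (card (residue_set N B)) \<le> N" for B
      proof -
        have "card (residue_set N B) \<le> card {0..<N}" by (rule card_mono) (auto simp: residue_set_def)
        then show ?thesis using N by simp
      qed
      have fm: "f s \<ge> m * n s - C" if "s \<in> residue_set N A" for s
        using f2[OF that] IH[OF finite_part[OF N A(1)], of s] unfolding n_def
        by (meson order_trans)
      \<comment> \<open>Only class \<open>s\<close> needs the better estimate; every other class
        keeps the old slope and costs \<open>C\<close>.\<close>
      have gain: "v \<ge> (m + \<delta>) * card A - (N * C + c)"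
        if s: "s \<in> residue_set N A" and g: "f s \<ge> m * n s + \<delta> * card A - c" and c: "c \<ge> 0" for s c
      proof -
        have "(\<Sum>t\<in>residue_set N A - {s}. m * n t - C) \<le> sum f (residue_set N A - {s})"
          by (intro sum_mono) (use fm in auto)
        moreover have "sum f (residue_set N A) = f s + sum f (residue_set N A - {s})"
          using s by (intro sum.remove) auto
        moreover have "(\<Sum>t\<in>residue_set N A. m * n t - C) = m * n s - C + (\<Sum>t\<in>residue_set N A - {s}. m * n t - C)"
          using s by (intro sum.remove) auto
        moreover have "(\<Sum>t\<in>residue_set N A. m * n t - C) = m * card A - card (residue_set N A) * C"
          unfolding nsum by (simp add: sum_subtractf sum_distrib_left)
        moreover have "card (residue_set N A) * C \<le> N * C" using card_res C by (intro mult_right_mono)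
        ultimately show ?thesis using fv g C by (simp add: algebra_simps)
      qed
      have gain': "v \<ge> m' * card A - C'"
        if "v \<ge> (m + \<delta>) * card A - c" "c \<le> C'" for c
      proof -
        have "m' * card A \<le> (m + \<delta>) * card A" using m' by (intro mult_right_mono) auto
        then show ?thesis using that by linarith
      qed
      \<comment> \<open>In the last case every class is larger than
        \<open>\<delta> * card A\<close>, so a gain equal to the size of any class suffices.\<close>
      consider (small) t where "t \<in> residue_set N A" "n t \<le> \<delta> * card A"
        | (full) "\<forall>s\<in>residue_set N A. residue_set N (part N s A) = {0..<N}"
        | (nonfull) s where "s \<in> residue_set N A" "residue_set N (part N s A) \<noteq> {0..<N}"
             "\<forall>t\<in>residue_set N A. n t > \<delta> * card A"
        by (meson not_le)
      then show ?thesis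
      proof cases
        case small
        have "m * n t \<le> S * (\<delta> * card A)" using small m d by (intro mult_mono) (auto simp: n_def)
        also have "\<dots> = card A / 2" using d by (metis mult.assoc mult.commute mult.left_commute times_divide_eq_right mult.right_neutral)
        finally have "m * n t + \<delta> * card A - 1 \<le> real (card A) - 1"
          using mult_right_mono[OF d(2), of "real (card A)"] by simp
        then have "v \<ge> (m + \<delta>) * card A - (N * C + 1)"
          using gain[OF small(1), of 1] f1[OF small(1)] by simp
        then show ?thesis
          by (rule gain') (use N C C0 S NC in \<open>simp add: C'_def\<close>)
      next
        case full
        have "f s \<ge> S * n s - C0" if s: "s \<in> residue_set N A" for s
        proof -
          obtain w :: real where "w \<le> f s" "R (part N s A) w" using f2[OF s] by blast
          then show ?thesis
            using assms(5)[of "part N s A" w] full s N A(1) unfolding n_def by fastforce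
        qed
        then have "(\<Sum>s\<in>residue_set N A. S * n s - C0) \<le> sum f (residue_set N A)" by (intro sum_mono)
        moreover have "(\<Sum>s\<in>residue_set N A. S * n s - C0) = S * card A - card (residue_set N A) * C0"
          unfolding nsum by (simp add: sum_subtractf sum_distrib_left)
        moreover have "card (residue_set N A) * C0 \<le> N * C0" using card_res C0 by (intro mult_right_mono)
        moreover have "m' * card A \<le> S * card A" using m' by (intro mult_right_mono) auto
        ultimately show ?thesis using fv N C S NC unfolding C'_def by linarith
      next
        case (nonfull s)
        let ?B = "part N s A"
        obtain w :: real where w: "w \<le> f s" "R ?B w" and alt: "(\<exists>t\<in>residue_set N A. f s \<ge> w + n t) \<or>
             (\<exists>u :: int \<Rightarrow> real. f s \<ge> sum u (residue_set N ?B) + n s - 1 \<and> (\<forall>t\<in>residue_set N ?B. R (part N t ?B) (u t)))"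
          using f2[OF nonfull(1)] nonfull(2) unfolding n_def by blast
        have "f s \<ge> m * n s + \<delta> * card A - (N * C + 1)"
          using alt
        proof
          assume "\<exists>t\<in>residue_set N A. f s \<ge> w + n t"
          then obtain t where "t \<in> residue_set N A" "f s \<ge> w + n t" by blast
          moreover have "w \<ge> m * n s - C" using IH[OF _ w(2)] N A(1) by (simp add: n_def)
          ultimately show ?thesis using nonfull(3) NC by fastforce
        next
          assume "\<exists>u :: int \<Rightarrow> real. f s \<ge> sum u (residue_set N ?B) + n s - 1 \<and> (\<forall>t\<in>residue_set N ?B. R (part N t ?B) (u t))"
          then obtain u :: "int \<Rightarrow> real" where u: "f s \<ge> sum u (residue_set N ?B) + n s - 1"
            "\<And>t. t \<in> residue_set N ?B \<Longrightarrow> R (part N t ?B) (u t)" by blast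
          \<comment> \<open>The old bound is applied to the subclasses of class \<open>s\<close>,
            whose sizes add up to \<open>n s\<close>; the term \<open>n s - 1\<close> is the
            gain.\<close>
          have "(\<Sum>t\<in>residue_set N ?B. m * card (part N t ?B) - C) \<le> sum u (residue_set N ?B)"
            using IH[OF _ u(2)] N A(1) by (intro sum_mono) simp
          moreover have "(\<Sum>t\<in>residue_set N ?B. m * card (part N t ?B) - C) = m * n s - card (residue_set N ?B) * C"
            unfolding n_def card_eq_sum_part[OF N finite_part[OF N A(1), of s]]
            by (simp add: sum_subtractf sum_distrib_left)
          moreover have "card (residue_set N ?B) * C \<le> N * C" using card_res C by (intro mult_right_mono)
          ultimately show ?thesis using u(1) nonfull(1,3) by fastforce
        qed
        then have "v \<ge> (m + \<delta>) * card A - (N * C + (N * C + 1))"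
          using gain[OF nonfull(1), of "N * C + 1"] NC C by simp
        then show ?thesis
          by (rule gain') (use N C C0 S NC in \<open>simp add: C'_def\<close>)
      qed
    qed
    \<comment> \<open>Induction on a bound for the diameter: a set that is not primitive lies in one
      class modulo some \<open>g > 1\<close> and can be divided by \<open>g\<close> without changing
      its size.\<close>
    have bounded: "v \<ge> m' * card A - C'"
      if "finite A" "R A v" "\<forall>a\<in>A. \<forall>b\<in>A. \<bar>a - b\<bar> \<le> int D" for A v D
      using that
    proof (induction D arbitrary: A v rule: less_induct)
      case (less D)
      show ?case
      proof (cases "D = 0")
        case True
        then have "card A \<le> 1" using card_le_1_of_dist_0 less.prems(3) by simp
        then have "m' * card A \<le> S * 1" using m' by (intro mult_mono) auto
        moreover have "C' \<ge> S" using C C0 NC by (simp add: C'_def)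
        ultimately show ?thesis using nonneg[OF less.prems(2,1)] by linarith
      next
        case False
        show ?thesis
        proof (cases "primitive N A")
          case True
          then show ?thesis using prim less.prems by blast
        next
          case False
          then obtain g s where g: "g > 1" "g dvd N" "\<forall>a\<in>A. a mod g = s"
            by (auto simp: primitive_def)
          obtain w where w: "w \<le> v" "R (part g s A) w"
            using single[OF less.prems(2,1) g] by blast
          have "\<bar>x - y\<bar> \<le> int (D - 1)" if "x \<in> part g s A" "y \<in> part g s A" for x y
          proof -
            have "\<bar>g * x + s - (g * y + s)\<bar> \<le> int D"
              using less.prems(3) that unfolding part_def by blast
            then have "g * \<bar>x - y\<bar> \<le> int D" using g(1)
              by (simp add: abs_mult flip: right_diff_distrib)
            moreover have "2 * \<bar>x - y\<bar> \<le> g * \<bar>x - y\<bar>" using g(1) by (intro mult_right_mono) auto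
            ultimately have "2 * \<bar>x - y\<bar> \<le> int D" by linarith
            then show ?thesis using \<open>D \<noteq> 0\<close> by arith
          qed
          then have "w \<ge> m' * card (part g s A) - C'"
            using less.IH[of "D - 1" "part g s A" w] w g less.prems(1) \<open>D \<noteq> 0\<close> by auto
          moreover have "card A = card (part g s A)"
          proof -
            have "inj_on (\<lambda>x. g * x + s) (part g s A)" using g(1) by (auto intro: inj_onI)
            then show ?thesis using part_single_class[of g A s] g by (metis card_image order_less_trans zero_less_one)
          qed
          ultimately show ?thesis using w by simp
        qed
      qed
    qed
    have diam: "\<exists>D. \<forall>a\<in>A. \<forall>b\<in>A. \<bar>a - b\<bar> \<le> int D" if "finite A" for A :: "int set"
    proof -
      have fin: "finite ((\<lambda>(a, b). nat \<bar>a - b\<bar>) ` (A \<times> A))" using that by simp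
      then have "\<forall>a\<in>A. \<forall>b\<in>A. nat \<bar>a - b\<bar> \<le> Max ((\<lambda>(a, b). nat \<bar>a - b\<bar>) ` (A \<times> A))"
        by (auto intro!: Max_ge)
      then show ?thesis by (metis nat_le_iff)
    qed
    have "v \<ge> m' * card A - C'" if "finite A" "R A v" for A v
      using diam[OF that(1)] bounded[OF that] by auto
    moreover have "C' \<ge> 0" using N C C0 S NC by (simp add: C'_def)
    ultimately show "\<exists>C'. K (min S (m + \<delta>)) C'" unfolding K_def m'_def by blast
  qed (use d S in auto)
  then show ?thesis by (auto simp: K_def)
qed

section \<open>Sums of dilates\<close>

definition dilate_sum :: "int list \<Rightarrow> int set \<Rightarrow> int set" where
  "dilate_sum lam A = sumset_list (map (\<lambda>l. dilate l A) lam)"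

lemma dilate_sum_Nil [simp]: "dilate_sum [] A = {0}"
  by (simp add: dilate_sum_def)

lemma dilate_sum_Cons [simp]: "dilate_sum (l # ls) A = dilate l A + dilate_sum ls A"
  by (auto simp: dilate_sum_def set_plus_def)

lemma dilate_iff: "x \<in> dilate d A \<longleftrightarrow> (\<exists>a\<in>A. x = d * a)"
  by (auto simp: dilate_def)

lemma finite_dilate [simp]: "finite A \<Longrightarrow> finite (dilate d A)"
  by (simp add: dilate_def)

lemma dilate_empty_iff [simp]: "dilate d A = {} \<longleftrightarrow> A = {}"
  by (simp add: dilate_def)

lemma plus_dilateI: "z \<in> Z \<Longrightarrow> a \<in> A \<Longrightarrow> x = z + q * a \<Longrightarrow> x \<in> Z + dilate q A"
  by (auto simp: dilate_iff intro!: set_plus_intro)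

lemma card_dilate: "d \<noteq> 0 \<Longrightarrow> card (dilate d A) = card A"
  unfolding dilate_def by (rule card_image) (auto intro: inj_onI)

lemma dilate_plus: "dilate d (A + B) = dilate d A + dilate d B"
  by (force simp: dilate_iff set_plus_def algebra_simps)

lemma dilate_dilate: "dilate d (dilate e A) = dilate (d * e) A"
  by (force simp: dilate_iff)

lemma set_plus_empty_iff [simp]: "A + B = {} \<longleftrightarrow> A = {} \<or> B = {}" for A B :: "int set"
  by (auto simp: set_plus_def)

lemma finite_dilate_sum [simp]: "finite A \<Longrightarrow> finite (dilate_sum M A)"
  by (induction M) (auto intro: finite_set_plus)

lemma dilate_sum_nonempty [simp]: "A \<noteq> {} \<Longrightarrow> dilate_sum M A \<noteq> {}"
  by (induction M) auto

lemma dilate_sum_scale: "dilate_sum (map ((*) h) M) A = dilate h (dilate_sum M A)"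
  by (induction M) (auto simp: dilate_plus dilate_dilate, simp_all add: dilate_def)

text \<open>In a sum of terms \<open>l * (N * x + s)\<close> the offsets collect the factor
  \<open>sum_list M\<close>. Hence class \<open>s\<close> of \<open>A\<close> feeds the class of
  \<open>sum_list M * s\<close>.\<close>

lemma dilate_sum_part: "y \<in> dilate_sum M (part N s A) \<Longrightarrow> N * y + sum_list M * s \<in> dilate_sum M A"
proof (induction M arbitrary: y)
  case (Cons l M)
  then obtain x y' where x: "x \<in> part N s A" "y' \<in> dilate_sum M (part N s A)" "y = l * x + y'"
    by (auto simp: set_plus_def dilate_iff)
  have "N * y + sum_list (l # M) * s = l * (N * x + s) + (N * y' + sum_list M * s)"
    using x by (simp add: algebra_simps)
  moreover have "l * (N * x + s) \<in> dilate l A" using x(1) by (auto simp: part_def dilate_iff)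
  ultimately show ?case using Cons.IH[OF x(2)] by (metis dilate_sum_Cons set_plus_intro)
qed simp

text \<open>Freeze all summands of \<open>x\<close> but one with coefficient \<open>\<mu>\<close>,
  and let that one run over \<open>A\<close>.\<close>

lemma dilate_sum_replace:
  assumes "x \<in> dilate_sum M A" "\<mu> \<in> set M"
  shows "\<exists>c. (\<exists>a\<in>A. x = c + \<mu> * a) \<and> (\<forall>b\<in>A. c + \<mu> * b \<in> dilate_sum M A)"
  using assms
proof (induction M arbitrary: x)
  case (Cons l M)
  then obtain a y where x: "a \<in> A" "y \<in> dilate_sum M A" "x = l * a + y"
    by (auto simp: set_plus_def dilate_iff)
  show ?case
  proof (cases "l = \<mu>")
    case True
    have "y + \<mu> * b \<in> dilate_sum (l # M) A" if "b \<in> A" for b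
      using plus_dilateI[OF x(2) that, of _ l] True by (simp add: add.commute)
    then show ?thesis using x True by (intro exI[of _ y]) auto
  next
    case False
    then have "\<mu> \<in> set M" using Cons.prems(2) by simp
    then obtain c where c: "\<exists>b\<in>A. y = c + \<mu> * b" "\<forall>b\<in>A. c + \<mu> * b \<in> dilate_sum M A"
      using Cons.IH[OF x(2)] by blast
    have "l * a + c + \<mu> * b \<in> dilate_sum (l # M) A" if "b \<in> A" for b
      using c(2) x(1) that plus_dilateI[of "c + \<mu> * b" "dilate_sum M A" a A _ l]
      by (simp add: add_ac)
    then show ?thesis using c(1) x by (intro exI[of _ "l * a + c"]) auto
  qed
qed simp

section \<open>Sizes of sumsets of integers\<close>

lemma card_translate: "card ((+) c ` A) = card A" for c :: int
  by (rule card_image) auto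

lemma card_le_set_plus:
  fixes A B :: "int set"
  assumes "finite A" "finite B" "B \<noteq> {}"
  shows "card A \<le> card (A + B)"
proof -
  obtain b where "b \<in> B" using assms by blast
  then have "(+) b ` A \<subseteq> A + B" by (auto simp: set_plus_def add.commute)
  then show ?thesis using assms by (metis card_mono card_translate finite_set_plus)
qed

text \<open>The translates of \<open>A\<close> by \<open>Min B\<close> and of \<open>B\<close> by
  \<open>Max A\<close> can meet only in \<open>Max A + Min B\<close>.\<close>

lemma card_set_plus_ge:
  fixes A B :: "int set"
  assumes "finite A" "finite B" "A \<noteq> {}" "B \<noteq> {}"
  shows "card A + card B \<le> card (A + B) + 1"
proof -
  let ?X = "(+) (Min B) ` A" and ?Y = "(+) (Max A) ` B"
  have mem: "Min B \<in> B" "Max A \<in> A" using assms by auto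
  then have "?X \<union> ?Y \<subseteq> A + B"
    using set_plus_intro[of _ A "Min B" B] set_plus_intro[of "Max A" A _ B] by (auto simp: add.commute)
  then have "card (?X \<union> ?Y) \<le> card (A + B)" using assms by (intro card_mono finite_set_plus)
  moreover have "?X \<inter> ?Y \<subseteq> {Max A + Min B}"
  proof
    fix x assume "x \<in> ?X \<inter> ?Y"
    then obtain a b where "a \<in> A" "b \<in> B" "x = Min B + a" "x = Max A + b" by auto
    moreover from this have "a \<le> Max A" "Min B \<le> b" using assms by auto
    ultimately show "x \<in> {Max A + Min B}" by simp
  qed
  then have "card (?X \<inter> ?Y) \<le> 1" by (metis card_mono finite.emptyI finite.insertI is_singletonI is_singleton_altdef)
  moreover have "card ?X + card ?Y = card (?X \<union> ?Y) + card (?X \<inter> ?Y)"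
    using assms by (intro card_Un_Int) auto
  ultimately show ?thesis by (simp add: card_translate)
qed

text \<open>Adding multiples of \<open>N\<close> preserves classes, so each class of
  \<open>Z\<close> receives the whole of \<open>A\<close>, dilated by \<open>q\<close>
  alone.\<close>

lemma part_plus_dilate: "part N e (Z + dilate (N * q) A) = part N e Z + dilate q A"
proof (intro equalityI subsetI)
  fix x assume "x \<in> part N e (Z + dilate (N * q) A)"
  then obtain z a where za: "z \<in> Z" "a \<in> A" "N * x + e = z + N * q * a"
    by (auto simp: part_def set_plus_def dilate_iff)
  then have "N * (x - q * a) + e = z" by (simp add: algebra_simps)
  then have "x - q * a \<in> part N e Z" using za by (simp add: part_def)
  then have "(x - q * a) + q * a \<in> part N e Z + dilate q A"
    using za by (intro set_plus_intro) (auto simp: dilate_iff)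
  then show "x \<in> part N e Z + dilate q A" by simp
next
  fix x assume "x \<in> part N e Z + dilate q A"
  then obtain y a where ya: "N * y + e \<in> Z" "a \<in> A" "x = y + q * a"
    by (auto simp: part_def set_plus_def dilate_iff)
  then have "N * x + e = (N * y + e) + N * q * a" by (simp add: algebra_simps)
  then show "x \<in> part N e (Z + dilate (N * q) A)"
    using ya unfolding part_def by (blast intro: plus_dilateI)
qed

section \<open>The increment from adding one dilate\<close>

definition excess :: "int set \<Rightarrow> int \<Rightarrow> int set \<Rightarrow> real" where
  "excess Z q A = real (card (Z + dilate q A)) - real (card Z)"

lemma excess_nonneg:
  "finite Z \<Longrightarrow> finite A \<Longrightarrow> A \<noteq> {} \<Longrightarrow> excess Z q A \<ge> 0"
  using card_le_set_plus[of Z "dilate q A"] by (simp add: excess_def)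

lemma excess_ge_card:
  "finite Z \<Longrightarrow> finite A \<Longrightarrow> Z \<noteq> {} \<Longrightarrow> A \<noteq> {} \<Longrightarrow> q \<noteq> 0 \<Longrightarrow> excess Z q A \<ge> real (card A) - 1"
  using card_set_plus_ge[of Z "dilate q A"] by (simp add: excess_def card_dilate)

lemma excess_eq_sum:
  assumes "finite Z" "finite A" "N > 0"
  shows "excess Z (N * q) A = (\<Sum>e\<in>{0..<N}. excess (part N e Z) q A)"
  unfolding excess_def sum_subtractf
  using assms by (simp add: card_eq_sum_part_all[of N] finite_set_plus part_plus_dilate)

text \<open>On class \<open>s\<close> of \<open>A\<close> one has
  \<open>q * (N * y + s) = q * s + N * q * y\<close>.\<close>

lemma translate_part_subset: "(+) (q * s) ` (Z + dilate (N * q) (part N s A)) \<subseteq> Z + dilate q A"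
proof
  fix x assume "x \<in> (+) (q * s) ` (Z + dilate (N * q) (part N s A))"
  then obtain z y where zy: "z \<in> Z" "N * y + s \<in> A" "x = q * s + (z + N * q * y)"
    by (auto simp: set_plus_def dilate_iff part_def)
  then have "x = z + q * (N * y + s)" by (simp add: algebra_simps)
  then show "x \<in> Z + dilate q A" using zy by (blast intro: plus_dilateI)
qed

lemma excess_part_le:
  assumes "finite Z" "finite A"
  shows "excess Z (N * q) (part N s A) \<le> excess Z q A"
proof -
  have "card ((+) (q * s) ` (Z + dilate (N * q) (part N s A))) \<le> card (Z + dilate q A)"
    using assms by (intro card_mono translate_part_subset finite_set_plus) auto
  then show ?thesis by (simp add: excess_def card_translate)
qed

text \<open>Translates are allowed so that the relation survives passing to residue classes of
  \<open>A\<close> and \<open>Z\<close>; beyond this \<open>Z\<close> is arbitrary.\<close>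

definition covers :: "int list \<Rightarrow> int set \<Rightarrow> int set \<Rightarrow> bool" where
  "covers M A Z \<longleftrightarrow> (\<exists>z. (+) z ` dilate_sum M A \<subseteq> Z)"

lemma part_translate_subset:
  assumes "(+) z ` dilate_sum M A \<subseteq> Z"
  defines "k \<equiv> \<lambda>s. sum_list M * s + z"
  shows "(+) (k s div N) ` dilate_sum M (part N s A) \<subseteq> part N (k s mod N) Z"
proof (rule image_subsetI)
  fix y assume "y \<in> dilate_sum M (part N s A)"
  then have "z + (N * y + sum_list M * s) \<in> Z"
    using assms(1) dilate_sum_part[of y M N s A] by blast
  also have "z + (N * y + sum_list M * s) = N * y + (N * (k s div N) + k s mod N)"
    unfolding mult_div_mod_eq by (simp add: k_def)
  also have "\<dots> = N * (k s div N + y) + k s mod N" by (simp only: distrib_left add_ac)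
  finally show "k s div N + y \<in> part N (k s mod N) Z" by (simp only: part_def mem_Collect_eq)
qed

lemma covers_nonempty: "covers M A Z \<Longrightarrow> A \<noteq> {} \<Longrightarrow> Z \<noteq> {}"
  unfolding covers_def using dilate_sum_nonempty[of A M] by (metis image_is_empty subset_empty)

text \<open>The stabiliser of \<open>T\<close> is a subgroup of the integers containing \<open>N\<close> and \<open>D\<close>.\<close>

lemma stable_set_modulus:
  fixes T D :: "int set"
  assumes "N > 0" and periodic: "\<And>x. x \<in> T \<Longrightarrow> x + N \<in> T" "\<And>x. x \<in> T \<Longrightarrow> x - N \<in> T"
    and stable: "\<And>x d. x \<in> T \<Longrightarrow> d \<in> D \<Longrightarrow> x + d \<in> T"
    and "T \<noteq> {}" "T \<noteq> UNIV"
  shows "\<exists>g>1. g dvd N \<and> (\<forall>d\<in>D. g dvd d)"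
proof -
  define H where "H = {d. \<forall>x\<in>T. x + d \<in> T}"
  have add: "d + e \<in> H" if "d \<in> H" "e \<in> H" for d e
    using that unfolding H_def by (auto simp flip: add.assoc)
  have H0: "0 \<in> H" and HN: "N \<in> H" "- N \<in> H" using periodic by (auto simp: H_def)
  have nat_mult: "int k * d \<in> H" if "d \<in> H" for k d
    by (induction k) (use H0 add that in \<open>auto simp: algebra_simps\<close>)
  have neg: "- d \<in> H" if "d \<in> H" for d
  proof -
    \<comment> \<open>Only natural multiples are available so far, so \<open>- d\<close> is written
      as \<open>(N - 1) * d - N * d\<close>, the second term being a natural multiple of
      \<open>N\<close> or \<open>- N\<close>.\<close>
    have "int (nat (N - 1)) * d + int (nat \<bar>d\<bar>) * (if d \<ge> 0 then - N else N) \<in> H"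
      using HN that by (intro add nat_mult) auto
    moreover have "int (nat (N - 1)) * d + int (nat \<bar>d\<bar>) * (if d \<ge> 0 then - N else N) = - d"
      using \<open>N > 0\<close> by (auto simp: algebra_simps)
    ultimately show ?thesis by simp
  qed
  have mult: "k * d \<in> H" if "d \<in> H" for k d
    using nat_mult[OF that, of "nat k"] nat_mult[OF neg[OF that], of "nat (- k)"]
    by (cases "k \<ge> 0") auto
  define g where "g = int (LEAST n. n > 0 \<and> int n \<in> H)"
  have ex: "nat N > 0 \<and> int (nat N) \<in> H" using HN \<open>N > 0\<close> by simp
  have g: "g > 0" "g \<in> H" using LeastI[of "\<lambda>n. n > 0 \<and> int n \<in> H", OF ex] by (auto simp: g_def)
  have dvd: "g dvd d" if "d \<in> H" for d
  proof (rule ccontr)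
    assume "\<not> g dvd d"
    then have "d mod g > 0" using g by (simp add: dvd_eq_mod_eq_0 order_less_le)
    moreover have "d mod g \<in> H"
      using add[OF that mult[OF g(2), of "- (d div g)"]] by (simp add: minus_div_mult_eq_mod[symmetric])
    ultimately have "(LEAST n. n > 0 \<and> int n \<in> H) \<le> nat (d mod g)"
      by (intro Least_le) auto
    then have "g \<le> d mod g" using \<open>d mod g > 0\<close> by (simp add: g_def)
    then show False using pos_mod_bound[OF g(1), of d] by linarith
  qed
  have "g \<noteq> 1"
  proof
    assume "g = 1"
    obtain x where "x \<in> T" using \<open>T \<noteq> {}\<close> by blast
    have "y \<in> T" for y
    proof -
      have "y - x \<in> H" using mult[OF g(2), of "y - x"] \<open>g = 1\<close> by simp
      then show ?thesis using \<open>x \<in> T\<close> by (force simp: H_def)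
    qed
    then show False using \<open>T \<noteq> UNIV\<close> by blast
  qed
  then have "g > 1" using g(1) by linarith
  moreover have "g dvd d" if "d \<in> D" for d using stable that by (intro dvd) (auto simp: H_def)
  ultimately show ?thesis using dvd[OF HN(1)] by blast
qed

text \<open>Were every class of \<open>Y + D\<close> met by \<open>Y + x0\<close>, the residues of
  \<open>Y\<close> would be stable under \<open>x - x0\<close> for all \<open>x \<in> D\<close>.
  Then some \<open>g > 1\<close> divides \<open>N\<close> and all these differences, and
  \<open>D\<close> lies in one class modulo \<open>g\<close>.\<close>

lemma extra_class:
  assumes "N > 0" "primitive N D" "Y \<noteq> {}" "residue_set N Y \<noteq> {0..<N}"
  shows "\<exists>y\<in>Y. \<exists>x\<in>D. \<forall>y'\<in>Y. \<not> [y + x = y' + x0] (mod N)"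
proof (rule ccontr)
  assume "\<not> ?thesis"
  then have *: "\<And>y x. y \<in> Y \<Longrightarrow> x \<in> D \<Longrightarrow> \<exists>y'\<in>Y. [y + x = y' + x0] (mod N)" by blast
  define T where "T = {t. \<exists>y\<in>Y. [t = y] (mod N)}"
  have "\<exists>g>1. g dvd N \<and> (\<forall>d\<in>(\<lambda>x. x - x0) ` D. g dvd d)"
  proof (rule stable_set_modulus[of N T])
    fix t d assume "t \<in> T" "d \<in> (\<lambda>x. x - x0) ` D"
    then obtain y x where y: "y \<in> Y" "[t = y] (mod N)" "x \<in> D" "d = x - x0" by (auto simp: T_def)
    obtain y' where y': "y' \<in> Y" "[y + x = y' + x0] (mod N)" using * y by blast
    have "[t + x = y' + x0] (mod N)"
      using cong_add[OF y(2) cong_refl[of x]] y'(2) cong_trans by blast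
    then have "[t + x - x0 = y' + x0 - x0] (mod N)" by (rule cong_diff) simp
    then show "t + d \<in> T" using y' y by (auto simp: T_def add_diff_eq)
  next
    show "T \<noteq> UNIV"
    proof
      assume U: "T = UNIV"
      have "s \<in> residue_set N Y" if "s \<in> {0..<N}" for s
      proof -
        have "s \<in> T" using U by simp
        then show ?thesis using that \<open>N > 0\<close> by (auto simp: residue_set_iff T_def cong_def)
      qed
      then show False using assms(4) by (auto simp: residue_set_def)
    qed
  qed (use assms in \<open>auto simp: T_def cong_def\<close>)
  then obtain g where "g > 1" "g dvd N" "\<forall>x\<in>D. g dvd x - x0" by auto
  then have "\<forall>x\<in>D. x mod g = x0 mod g" by (auto simp: mod_eq_dvd_iff)
  then show False using assms(2) \<open>g > 1\<close> \<open>g dvd N\<close> by (auto simp: primitive_def)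
qed

text \<open>If the sum lies in one class modulo \<open>g\<close>, varying a single summand shows
  that \<open>g\<close> divides \<open>(a - a0) * \<mu>\<close> for each coefficient
  \<open>\<mu>\<close>. It also divides \<open>N\<close>, so coprimality gives
  \<open>g dvd a - a0\<close>.\<close>

lemma primitive_dilate_sum:
  assumes "gcd N (Gcd (set M)) = 1" "A \<noteq> {}" "primitive N A"
  shows "primitive N (dilate_sum M A)"
  unfolding primitive_def
proof safe
  fix g s assume g: "g > 1" "g dvd N" "\<forall>x\<in>dilate_sum M A. x mod g = s"
  obtain x where x: "x \<in> dilate_sum M A" using assms dilate_sum_nonempty by blast
  obtain a0 where a0: "a0 \<in> A" using assms by blast
  have "a mod g = a0 mod g" if a: "a \<in> A" for a
  proof -
    have "g dvd (a - a0) * \<mu>" if \<mu>: "\<mu> \<in> set M" for \<mu>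
    proof -
      obtain c where "\<forall>b\<in>A. c + \<mu> * b \<in> dilate_sum M A" using dilate_sum_replace[OF x \<mu>] by blast
      then have "(c + \<mu> * a) mod g = (c + \<mu> * a0) mod g" using g a a0 by simp
      then show ?thesis by (simp add: mod_eq_dvd_iff algebra_simps)
    qed
    then have "g dvd Gcd ((*) (a - a0) ` set M)" by (intro Gcd_greatest) auto
    then have "g dvd (a - a0) * Gcd (set M)" by (simp add: Gcd_mult)
    moreover have "g dvd (a - a0) * N" using g by simp
    ultimately have "g dvd gcd ((a - a0) * N) ((a - a0) * Gcd (set M))" by (rule gcd_greatest[rotated])
    also have "gcd ((a - a0) * N) ((a - a0) * Gcd (set M)) = \<bar>a - a0\<bar>"
      unfolding gcd_mult_distrib_int[symmetric] assms(1) by simp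
    finally show ?thesis by (simp add: mod_eq_dvd_iff)
  qed
  then show False using assms(3) g by (auto simp: primitive_def)
qed

text \<open>\<open>N\<close> is the part of \<open>q\<close> composed of the primes dividing \<open>h\<close>.\<close>

lemma smooth_part:
  fixes q h :: int
  assumes "q \<noteq> 0" "h dvd q" "h > 0"
  obtains N where "N > 0" "N dvd q" "h dvd N" "coprime N (q div N)"
    "\<And>x. coprime x h \<Longrightarrow> coprime x N"
proof -
  \<comment> \<open>The last condition says, without factorisations, that every prime dividing
    \<open>N\<close> divides \<open>h\<close>.\<close>
  define X where "X = {N. N > 0 \<and> N dvd q \<and> (\<forall>x. coprime x h \<longrightarrow> coprime x N)}"
  have "X \<subseteq> {0..\<bar>q\<bar>}" using assms by (auto simp: X_def dest: dvd_imp_le_int)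
  then have fin: "finite X" by (rule finite_subset) simp
  have "1 \<in> X" by (simp add: X_def)
  define N where "N = Max X"
  have "N \<in> X" using fin \<open>1 \<in> X\<close> unfolding N_def by (intro Max_in) auto
  then have N: "N > 0" "N dvd q" "\<And>x. coprime x h \<Longrightarrow> coprime x N" by (auto simp: X_def)
  have max: "n \<le> N" if "n \<in> X" for n using fin that by (simp add: N_def)
  have "lcm N h \<in> X"
  proof -
    have "coprime x (lcm N h)" if "coprime x h" for x
    proof -
      have "coprime x (N * h)" using N(3) that by simp
      moreover have "lcm N h dvd N * h" by (intro lcm_least) auto
      ultimately show ?thesis using coprime_divisors[OF dvd_refl] by blast
    qed
    then show ?thesis using N assms by (simp add: X_def lcm_pos_int)
  qed
  then have "lcm N h \<le> N" by (rule max)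
  moreover have "N \<le> lcm N h" using N(1) assms(3) by (intro zdvd_imp_le) (auto simp: lcm_pos_int)
  ultimately have "h dvd N" by (metis dvd_lcm2 order_antisym)
  moreover have "coprime N (q div N)"
  proof (rule ccontr)
    assume c: "\<not> coprime N (q div N)"
    \<comment> \<open>A common factor could be moved from \<open>q div N\<close> into
      \<open>N\<close>, against maximality.\<close>
    define p where "p = gcd N (q div N)"
    have "p > 0" "p \<noteq> 1"
      using c N(1) unfolding p_def coprime_iff_gcd_eq_1 by (auto simp: gcd_pos_int)
    then have "p > 1" by linarith
    have p: "p dvd N" "p dvd q div N" by (simp_all add: p_def)
    have "N * p dvd q" using p(2) N by (metis dvd_mult_div_cancel mult_dvd_mono dvd_refl)
    moreover have "coprime x (N * p)" if "coprime x h" for x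
      by (simp add: N(3)[OF that] coprime_divisors[OF dvd_refl p(1) N(3)[OF that]])
    ultimately have "N * p \<in> X" using N \<open>p > 1\<close> by (auto simp: X_def)
    then have "N * p \<le> N" by (rule max)
    then show False using N(1) \<open>p > 1\<close> by (simp add: mult_le_cancel_left2)
  qed
  ultimately show thesis using that N by blast
qed

section \<open>Adding one dilate\<close>

lemma sum_inj_residues_le:
  fixes F :: "int \<Rightarrow> real"
  assumes "inj_on e X" "e ` X \<subseteq> {0..<N}" "\<And>i. F i \<ge> 0"
  shows "(\<Sum>s\<in>X. F (e s)) \<le> (\<Sum>i\<in>{0..<N}. F i)"
proof -
  have "(\<Sum>s\<in>X. F (e s)) = sum F (e ` X)" using assms by (simp add: sum.reindex)
  also have "\<dots> \<le> sum F {0..<N}" using assms by (intro sum_mono2) auto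
  finally show ?thesis .
qed

lemma residue_set_subset: "residue_set N A \<subseteq> {0..<N}"
  by (auto simp: residue_set_def)

lemma affine_residue_inj:
  fixes N :: int
  assumes "coprime \<sigma> N"
  shows "inj_on (\<lambda>s. (\<sigma> * s + z) mod N) {0..<N}"
proof (rule inj_onI)
  fix s t assume st: "s \<in> {0..<N}" "t \<in> {0..<N}" "(\<sigma> * s + z) mod N = (\<sigma> * t + z) mod N"
  then have "[\<sigma> * s = \<sigma> * t] (mod N)" using cong_add_rcancel by (auto simp: cong_def[symmetric])
  then have "[s = t] (mod N)" using assms by (simp add: cong_mult_lcancel)
  then show "s = t" using st by (simp add: cong_def)
qed

lemma card_disjoint_subsets_le:
  "finite U \<Longrightarrow> P \<subseteq> U \<Longrightarrow> Q \<subseteq> U \<Longrightarrow> P \<inter> Q = {} \<Longrightarrow> card P + card Q \<le> card U"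
  by (metis card_Un_disjoint card_mono finite_subset le_sup_iff)

section \<open>Adding one dilate, split modulo \<open>N\<close>\<close>

context
  fixes M :: "int list" and N q' :: int
  assumes N: "N > 0" and cop: "coprime (sum_list M) N"
begin

text \<open>Coprimality makes \<open>e\<close> injective, so distinct classes of \<open>A\<close>
  use distinct classes of \<open>Z\<close>, and their increments add up. An occupied class of
  \<open>Z\<close> outside the image of \<open>e\<close> adds at least
  \<open>card A - 1\<close>.\<close>

lemma excess_decomposition:
  assumes "finite A" "A \<noteq> {}" "finite Z" and z: "(+) z ` dilate_sum M A \<subseteq> Z"
  defines "e \<equiv> \<lambda>s. (sum_list M * s + z) mod N"
  shows "(\<Sum>s\<in>residue_set N A. excess (part N (e s) Z) q' A) \<le> excess Z (N * q') A"
    and "q' \<noteq> 0 \<Longrightarrow> i \<in> residue_set N Z \<Longrightarrow> i \<notin> e ` residue_set N A \<Longrightarrow>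
      (\<Sum>s\<in>residue_set N A. excess (part N (e s) Z) q' A) + card A - 1 \<le> excess Z (N * q') A"
proof -
  let ?F = "\<lambda>i. excess (part N i Z) q' A"
  have inj: "inj_on e (residue_set N A)" and range: "e ` residue_set N A \<subseteq> {0..<N}"
    using inj_on_subset[OF affine_residue_inj[OF cop] residue_set_subset] N unfolding e_def by auto
  have nonneg: "?F i \<ge> 0" for i using assms N by (intro excess_nonneg) auto
  have eq: "excess Z (N * q') A = (\<Sum>i\<in>{0..<N}. ?F i)"
    using assms N by (intro excess_eq_sum)
  show "(\<Sum>s\<in>residue_set N A. ?F (e s)) \<le> excess Z (N * q') A"
    unfolding eq by (rule sum_inj_residues_le[OF inj range nonneg])
  assume i: "q' \<noteq> 0" "i \<in> residue_set N Z" "i \<notin> e ` residue_set N A"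
  have "(\<Sum>s\<in>residue_set N A. ?F (e s)) + ?F i = sum ?F (insert i (e ` residue_set N A))"
    using i inj by (simp add: sum.reindex)
  also have "\<dots> \<le> sum ?F {0..<N}"
    using i range nonneg by (intro sum_mono2) (auto simp: residue_set_def)
  finally show "(\<Sum>s\<in>residue_set N A. ?F (e s)) + card A - 1 \<le> excess Z (N * q') A"
    using excess_ge_card[of "part N i Z" A q'] i assms N unfolding eq by (auto simp: residue_set_def)
qed

text \<open>Let \<open>?Y\<close> be the class of \<open>Z\<close> belonging to a class
  \<open>?B\<close> of \<open>A\<close> that misses a residue. Either \<open>?Y\<close> has a
  subclass not forced by \<open>?B\<close>, or it misses a residue as well and adding
  \<open>dilate q' A\<close> reaches a new one.\<close>

lemma excess_split:
  fixes q defines "q \<equiv> N * q'"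
  defines "R \<equiv> \<lambda>A v. A \<noteq> {} \<and> (\<exists>Z. finite Z \<and> covers M A Z \<and> v = excess Z q A)"
  assumes "R A v" "finite A" "primitive N A" "coprime N q'" "q' \<noteq> 0"
  shows "splits_with_gain R N A v"
proof -
  obtain Z z where Z: "A \<noteq> {}" "finite Z" "(+) z ` dilate_sum M A \<subseteq> Z" "v = excess Z q A"
    using assms unfolding R_def covers_def by blast
  define e where "e z s = (sum_list M * s + z) mod N" for z s
  have part_cov: "\<exists>z'. (+) z' ` dilate_sum M (part N s B) \<subseteq> part N (e z s) Y"
    if "(+) z ` dilate_sum M B \<subseteq> Y" for s B Y z
    using part_translate_subset[OF that] unfolding e_def by blast
  have R_part: "R (part N s B) (excess (part N (e z s) Y) q (part N s B))"
    if "finite Y" "(+) z ` dilate_sum M B \<subseteq> Y" "s \<in> residue_set N B" for s B Y z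
    unfolding R_def covers_def
  proof (intro conjI exI[of _ "part N (e z s) Y"])
    show "part N s B \<noteq> {}" using that(3) by (simp add: residue_set_def)
  qed (use part_cov[OF that(2)] that(1) N in simp_all)
  define f where "f s = excess (part N (e z s) Z) q' A" for s
  have "sum f (residue_set N A) \<le> v"
    using excess_decomposition(1)[OF \<open>finite A\<close> Z(1-3)] unfolding Z(4) q_def f_def e_def by simp
  moreover have "f s \<ge> real (card A) - 1 \<and>
          (\<exists>w::real. w \<le> f s \<and> R (part N s A) w \<and>
            (residue_set N (part N s A) = {0..<N} \<or>
             (\<exists>t\<in>residue_set N A. f s \<ge> w + card (part N t A)) \<or>
             (\<exists>u :: int \<Rightarrow> real. f s \<ge> sum u (residue_set N (part N s A)) + card (part N s A) - 1 \<and>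
                (\<forall>t\<in>residue_set N (part N s A). R (part N t (part N s A)) (u t)))))"
    if s: "s \<in> residue_set N A" for s
  proof -
    let ?B = "part N s A" and ?Y = "part N (e z s) Z"
    obtain z' where z': "(+) z' ` dilate_sum M ?B \<subseteq> ?Y" using part_cov[OF Z(3)] by blast
    have B: "finite ?B" "?B \<noteq> {}" using N \<open>finite A\<close> s by (auto simp: residue_set_def)
    have Y: "finite ?Y" "?Y \<noteq> {}"
      using N Z z' B covers_nonempty[of M ?B ?Y] by (auto simp: covers_def)
    define w where "w = excess ?Y q ?B"
    have w: "w \<le> f s" "R ?B w"
      using excess_part_le[OF Y(1) \<open>finite A\<close>] R_part[OF Z(2,3) s] by (auto simp: w_def f_def q_def)
    have "f s \<ge> real (card A) - 1"
      unfolding f_def using Y Z \<open>finite A\<close> \<open>q' \<noteq> 0\<close> by (intro excess_ge_card)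
    moreover have "residue_set N ?B = {0..<N} \<or> (\<exists>t\<in>residue_set N A. f s \<ge> w + card (part N t A)) \<or>
             (\<exists>u :: int \<Rightarrow> real. f s \<ge> sum u (residue_set N ?B) + card ?B - 1 \<and>
                (\<forall>t\<in>residue_set N ?B. R (part N t ?B) (u t)))"
    proof (rule ccontr)
      assume contra: "\<not> ?thesis"
      then have nf: "residue_set N ?B \<noteq> {0..<N}"
        and not_full: "\<not> (\<exists>t\<in>residue_set N A. f s \<ge> w + card (part N t A))" by blast+
      from contra have no_u: "\<nexists>u :: int \<Rightarrow> real. f s \<ge> sum u (residue_set N ?B) + card ?B - 1 \<and>
                (\<forall>t\<in>residue_set N ?B. R (part N t ?B) (u t))" by blast
      show False
      proof -
        \<comment> \<open>A subclass of \<open>?Y\<close> beyond those forced by \<open>?B\<close>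
          would realise the alternative with \<open>u\<close>.\<close>
        have "i \<in> e z' ` residue_set N ?B" if i: "i \<in> residue_set N ?Y" for i
        proof (rule ccontr)
          assume i': "i \<notin> e z' ` residue_set N ?B"
          let ?u = "\<lambda>t. excess (part N (e z' t) ?Y) q (part N t ?B)"
          have "sum ?u (residue_set N ?B) \<le> (\<Sum>t\<in>residue_set N ?B. excess (part N (e z' t) ?Y) q' ?B)"
            unfolding q_def using Y B N by (intro sum_mono excess_part_le) auto
          moreover have "(\<Sum>t\<in>residue_set N ?B. excess (part N (e z' t) ?Y) q' ?B) + card ?B - 1 \<le> w"
            using excess_decomposition(2)[OF B Y(1) z' \<open>q' \<noteq> 0\<close> i] i' unfolding w_def q_def e_def by simp
          ultimately have "f s \<ge> sum ?u (residue_set N ?B) + card ?B - 1" using w(1) by linarith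
          then show False using no_u R_part[OF Y(1) z'] by blast
        qed
        then have "residue_set N ?Y \<subseteq> e z' ` residue_set N ?B" by blast
        then have "card (residue_set N ?Y) \<le> card (residue_set N ?B)"
          by (meson card_image_le card_mono finite_imageI finite_res order_trans)
        also have "\<dots> < card {0..<N}" using nf residue_set_subset by (intro psubset_card_mono) auto
        finally have nfY: "residue_set N ?Y \<noteq> {0..<N}" by auto
        \<comment> \<open>The one-element list stands for \<open>dilate q' A\<close>; this is where
          \<open>q'\<close> has to be coprime to \<open>N\<close>.\<close>
        have "primitive N (dilate_sum [q'] A)"
          using assms Z(1) by (intro primitive_dilate_sum) (auto simp: coprime_iff_gcd_eq_1)
        from extra_class[OF N this Y(2) nfY, of "q' * s"]
        obtain y a where ya: "y \<in> ?Y" "a \<in> A" and new: "\<And>y'. y' \<in> ?Y \<Longrightarrow> \<not> [y + q' * a = y' + q' * s] (mod N)"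
          by (auto simp: dilate_iff)
        define t where "t = a mod N"
        have t: "t \<in> residue_set N A" using ya N by (auto simp: residue_set_iff t_def)
        \<comment> \<open>\<open>P\<close> stays in the classes of \<open>y' + q' * s\<close> with
          \<open>y' \<in> ?Y\<close>, while all of \<open>Q\<close> lies in the new class of
          \<open>y + q' * a\<close>.\<close>
        define P where "P = (+) (q' * s) ` (?Y + dilate q ?B)"
        define Q where "Q = (\<lambda>b. y + q' * b) ` {b \<in> A. [b = t] (mod N)}"
        have "card P + card Q \<le> card (?Y + dilate q' A)"
        proof (rule card_disjoint_subsets_le)
          show "finite (?Y + dilate q' A)" using Y \<open>finite A\<close> by (intro finite_set_plus) auto
          show "P \<subseteq> ?Y + dilate q' A" unfolding P_def q_def by (rule translate_part_subset)
          show "Q \<subseteq> ?Y + dilate q' A" unfolding Q_def using ya by (auto intro: plus_dilateI)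
          show "P \<inter> Q = {}"
          proof (rule ccontr)
            assume "P \<inter> Q \<noteq> {}"
            then obtain y' c b where y': "y' \<in> ?Y" "b \<in> A" "[b = t] (mod N)"
              "q' * s + (y' + q * c) = y + q' * b"
              unfolding P_def Q_def by (auto simp: set_plus_def dilate_iff)
            have "[b = a] (mod N)" using y'(3) by (simp add: cong_def t_def)
            then have "[y + q' * b = y + q' * a] (mod N)" by (intro cong_add cong_mult) auto
            moreover have "[y + q' * b = y' + q' * s] (mod N)"
              unfolding y'(4)[symmetric] q_def by (simp add: cong_iff_dvd_diff algebra_simps)
            ultimately show False using new[OF y'(1)] by (meson cong_sym cong_trans)
          qed
        qed
        moreover have "card Q = card (part N t A)"
          unfolding Q_def card_part_class[OF N] using \<open>q' \<noteq> 0\<close> by (intro card_image) (auto intro: inj_onI)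
        moreover have "card P = card (?Y + dilate q ?B)" by (simp add: P_def card_translate)
        ultimately have "f s \<ge> w + card (part N t A)" by (simp add: f_def w_def excess_def)
        then show False using not_full t by blast
      qed
    qed
    ultimately show ?thesis using w by blast
  qed
  ultimately show ?thesis unfolding splits_with_gain_def by blast
qed

end

text \<open>With \<open>q = g * k\<close>, the increments of the classes of \<open>Z\<close> modulo
  \<open>g\<close> add up to the total; the one class known to cover the reduced set is
  kept.\<close>

lemma excess_single_class:
  assumes "finite Z" "finite A" "A \<noteq> {}" "covers M A Z" "g > 0" "g dvd q" "\<forall>a\<in>A. a mod g = s"
  shows "\<exists>Z'. finite Z' \<and> covers M (part g s A) Z' \<and> excess Z' q (part g s A) \<le> excess Z q A"
proof -
  obtain z where z: "(+) z ` dilate_sum M A \<subseteq> Z" using assms by (auto simp: covers_def)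
  obtain k where k: "q = g * k" using assms by blast
  let ?i = "(sum_list M * s + z) mod g"
  let ?Z' = "part g ?i Z"
  have "excess ?Z' q (part g s A) \<le> excess ?Z' k A"
    unfolding k using assms by (intro excess_part_le) auto
  also have "\<dots> \<le> (\<Sum>i\<in>{0..<g}. excess (part g i Z) k A)"
    using assms by (intro member_le_sum excess_nonneg) auto
  also have "\<dots> = excess Z q A" unfolding k using assms by (intro excess_eq_sum[symmetric])
  finally show ?thesis using assms part_translate_subset[OF z, of s g]
    by (intro exI[of _ ?Z']) (auto simp: covers_def)
qed

lemma residue_set_full_residue:
  assumes "N > 0" "residue_set N A = {0..<N}"
  shows "\<exists>a\<in>A. [a = x] (mod N)"
proof -
  have "x mod N \<in> residue_set N A" using assms by simp
  then show ?thesis using residue_set_iff[OF assms(1)] by (auto simp: cong_def)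
qed

lemma Gcd_mult_image: "h > 0 \<Longrightarrow> Gcd ((*) h ` X) = h * Gcd X" for h :: int
  by (simp add: Gcd_mult)

text \<open>As \<open>\<mu>\<close> is invertible modulo \<open>h\<close>,
  \<open>dilate \<mu> A\<close> meets every class modulo \<open>h\<close>. So each of the
  \<open>h\<close> classes of \<open>Z\<close> contains a translate of the sum for \<open>M\<close>
  and contributes at least \<open>b\<close>.\<close>

lemma excess_lower_bound_full:
  assumes h: "h > 0" "coprime \<mu> h" and full: "\<And>x. \<exists>a\<in>A. [a = x] (mod h)"
    and AZ: "finite A" "finite Z" "covers (\<mu> # map ((*) h) M) A Z"
    and IH: "\<And>Z. finite Z \<Longrightarrow> covers M A Z \<Longrightarrow> excess Z q A \<ge> b"
  shows "excess Z (h * q) A \<ge> h * b"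
proof -
  obtain z where z: "(+) z ` dilate_sum (\<mu> # map ((*) h) M) A \<subseteq> Z" using AZ by (auto simp: covers_def)
  have "covers M A (part h i Z)" for i
  proof -
    obtain x where x: "[\<mu> * x = 1] (mod h)" using h(2) cong_solve_coprime_int by blast
    obtain a where a: "a \<in> A" "[a = x * (i - z)] (mod h)" using full by blast
    have "[\<mu> * a = \<mu> * (x * (i - z))] (mod h)" using a(2) by (intro cong_mult) auto
    also have "[\<mu> * (x * (i - z)) = 1 * (i - z)] (mod h)"
      unfolding mult.assoc[symmetric] using x by (intro cong_mult) auto
    finally have "h dvd \<mu> * a - (i - z)" by (simp add: cong_iff_dvd_diff)
    then obtain k where k: "\<mu> * a - (i - z) = h * k" by blast
    have "k + y \<in> part h i Z" if "y \<in> dilate_sum M A" for y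
    proof -
      have "z + (\<mu> * a + h * y) \<in> Z"
        using z set_plus_intro[of "\<mu> * a" "dilate \<mu> A" "h * y" "dilate h (dilate_sum M A)"] a(1) that
        by (auto simp: dilate_sum_scale dilate_iff)
      moreover have "z + (\<mu> * a + h * y) = h * (k + y) + i" using k by (simp add: algebra_simps)
      ultimately show ?thesis by (simp add: part_def)
    qed
    then show ?thesis by (auto simp: covers_def)
  qed
  then have "(\<Sum>i\<in>{0..<h}. b) \<le> (\<Sum>i\<in>{0..<h}. excess (part h i Z) q A)"
    using AZ h by (intro sum_mono IH) auto
  then show ?thesis using h AZ by (simp add: excess_eq_sum)
qed

text \<open>Dividing \<open>q\<close> and the tail by their gcd \<open>h\<close> gives a shorter
  coprime instance, which settles sets meeting all classes; the bootstrap does the rest. The tail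
  changes under division, hence the induction on length.\<close>

lemma excess_lower_bound:
  assumes "gcd q (Gcd (set M)) = 1"
  shows "\<exists>C::real. C \<ge> 0 \<and> (\<forall>A Z. finite A \<longrightarrow> A \<noteq> {} \<longrightarrow> finite Z \<longrightarrow> covers M A Z \<longrightarrow>
           excess Z q A \<ge> real_of_int \<bar>q\<bar> * card A - C)"
  using assms
proof (induction M arbitrary: q rule: length_induct)
  case (1 L)
  show ?case
  proof (cases L)
    case Nil
    then have q: "\<bar>q\<bar> = 1" using 1 by simp
    have "excess Z q A \<ge> real_of_int \<bar>q\<bar> * card A - 1" if "finite A" "A \<noteq> {}" "finite Z" "covers [] A Z" for A Z
      using excess_ge_card[of Z A q] covers_nonempty[of "[]" A Z] that q by auto
    then show ?thesis using Nil by (intro exI[of _ 1]) auto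
  next
    case (Cons \<mu> M)
    show ?thesis
    proof (cases "q = 0")
      case True
      then show ?thesis using excess_nonneg by (intro exI[of _ 0]) auto
    next
      case False
      define h where "h = gcd q (Gcd (set M))"
      have h: "h > 0" "h dvd q" "\<And>m. m \<in> set M \<Longrightarrow> h dvd m"
        using False by (auto simp: h_def intro: dvd_trans[OF gcd_dvd2 Gcd_dvd])
      define q1 where "q1 = q div h"
      define M1 where "M1 = map (\<lambda>m. m div h) M"
      have q1: "q = h * q1" using h by (simp add: q1_def)
      have M1: "M = map ((*) h) M1" unfolding M1_def by (simp add: comp_def) (intro map_idI[symmetric], simp add: h)
      have "h * gcd q1 (Gcd (set M1)) = gcd q (Gcd (set M))"
        using h(1) gcd_mult_distrib_int[of h q1 "Gcd (set M1)"] unfolding q1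
        by (subst M1) (simp add: Gcd_mult_image)
      then have "gcd q1 (Gcd (set M1)) = 1" using h(1) by (simp flip: h_def)
      moreover have "length M1 < length L" by (simp add: M1_def Cons)
      ultimately have ex: "\<exists>C::real. C \<ge> 0 \<and> (\<forall>A Z. finite A \<longrightarrow> A \<noteq> {} \<longrightarrow> finite Z \<longrightarrow> covers M1 A Z \<longrightarrow>
           excess Z q1 A \<ge> real_of_int \<bar>q1\<bar> * card A - C)"
        using 1(1) by simp
      obtain C1 :: real where C1: "C1 \<ge> 0" and IH: "\<And>A Z. finite A \<Longrightarrow> A \<noteq> {} \<Longrightarrow> finite Z \<Longrightarrow>
          covers M1 A Z \<Longrightarrow> excess Z q1 A \<ge> real_of_int \<bar>q1\<bar> * card A - C1"
        using ex by auto
      \<comment> \<open>\<open>h\<close> itself would not do as modulus: a new class of \<open>Y + q' A\<close> is found only if \<open>q'\<close> is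
        coprime to the modulus.\<close>
      obtain N where N: "N > 0" "N dvd q" "h dvd N" "coprime N (q div N)"
          "\<And>x. coprime x h \<Longrightarrow> coprime x N"
        using smooth_part[OF False h(2,1)] by blast
      have cop_\<mu>: "coprime \<mu> h"
      proof -
        have "gcd \<mu> h = gcd q (Gcd (set L))" unfolding h_def Cons by (simp add: gcd.left_commute)
        then show ?thesis using 1(2) by (simp add: coprime_iff_gcd_eq_1)
      qed
      \<comment> \<open>Modulo \<open>h\<close> the sum of all coefficients is just
        \<open>\<mu>\<close>.\<close>
      have "h dvd sum_list M" using h(3) by (induction M) auto
      then have "coprime (sum_list L) h"
        using cop_\<mu> unfolding Cons
        by (metis coprime_iff_gcd_eq_1 dvd_def gcd_add_mult gcd.commute mult.commute sum_list.Cons add.commute)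
      then have cop_N: "coprime (sum_list L) N" by (rule N(5))
      define q' where "q' = q div N"
      have q': "q = N * q'" "q' \<noteq> 0" using N(2) False by (auto simp: q'_def)
      \<comment> \<open>Admitting the increments of all covering sets \<open>Z\<close> as values
        makes the resulting constant uniform in \<open>Z\<close>.\<close>
      define R where "R A v \<longleftrightarrow> A \<noteq> {} \<and> (\<exists>Z. finite Z \<and> covers L A Z \<and> v = excess Z q A)" for A v
      have "\<exists>C\<ge>0::real. \<forall>A v. finite A \<longrightarrow> R A v \<longrightarrow> v \<ge> real_of_int \<bar>q\<bar> * card A - C"
      proof (rule linear_bound_bootstrap[where R = R and N = N and ?C0.0 = "h * C1"])
        show "N > 0" by fact
        show "real_of_int \<bar>q\<bar> \<ge> 1" using False by linarith
        show "h * C1 \<ge> 0" using h(1) C1 by simp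
      next
        fix A v assume "R A v" "finite A"
        then show "v \<ge> 0" using excess_nonneg by (auto simp: R_def)
      next
        fix A v assume Rv: "R A v" and A: "finite A" "residue_set N A = {0..<N}"
        then obtain Z where Z: "A \<noteq> {}" "finite Z" "covers L A Z" "v = excess Z q A" by (auto simp: R_def)
        have "excess Z (h * q1) A \<ge> h * (real_of_int \<bar>q1\<bar> * card A - C1)"
        proof (rule excess_lower_bound_full[OF h(1) cop_\<mu> _ A(1) Z(2)])
          show "\<exists>a\<in>A. [a = x] (mod h)" for x
            using residue_set_full_residue[OF N(1) A(2), of x] cong_dvd_modulus[OF _ N(3)] by blast
          show "covers (\<mu> # map ((*) h) M1) A Z" using Z(3) M1 Cons by simp
        qed (use IH A Z in auto)
        then show "v \<ge> real_of_int \<bar>q\<bar> * card A - h * C1"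
          using h(1) unfolding Z(4) q1 by (simp add: algebra_simps abs_mult)
      next
        fix A v g s
        assume "R A v" "finite A" "g > 1" "g dvd N" "\<forall>a\<in>A. a mod g = s"
        then show "\<exists>w\<le>v. R (part g s A) w"
          using excess_single_class[of _ A L g q s] part_single_class[of g A s] N(2)
          unfolding R_def by (metis dvd_trans image_empty less_trans zero_less_one)
      next
        fix A v assume "R A v" "finite A" "primitive N A"
        then show "splits_with_gain R N A v"
          using excess_split[OF N(1) cop_N, of A v q'] q' N(4) unfolding R_def q'_def[symmetric] by blast
      qed
      then obtain C :: real where C: "C \<ge> 0"
        "\<And>A v. finite A \<Longrightarrow> R A v \<Longrightarrow> v \<ge> real_of_int \<bar>q\<bar> * card A - C" by blast
      have "excess Z q A \<ge> real_of_int \<bar>q\<bar> * card A - C"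
        if "finite A" "A \<noteq> {}" "finite Z" "covers L A Z" for A Z
        using that by (intro C(2)) (auto simp: R_def)
      then show ?thesis using C(1) by blast
    qed
  qed
qed

section \<open>All dilates\<close>

lemma card_dilate_sum_ge:
  assumes "finite A" "\<mu> \<in> set M" "\<mu> \<noteq> 0"
  shows "card A \<le> card (dilate_sum M A)"
proof (cases "A = {}")
  case False
  then obtain x where "x \<in> dilate_sum M A" using dilate_sum_nonempty by blast
  then obtain c where c: "\<forall>b\<in>A. c + \<mu> * b \<in> dilate_sum M A" using dilate_sum_replace assms(2) by blast
  have "card A = card ((\<lambda>b. c + \<mu> * b) ` A)"
    using assms(3) by (intro card_image[symmetric]) (auto intro: inj_onI)
  also have "\<dots> \<le> card (dilate_sum M A)" using c assms(1) by (intro card_mono) auto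
  finally show ?thesis .
qed simp

definition abs_sum :: "int list \<Rightarrow> real" where
  "abs_sum lam = (\<Sum>l\<leftarrow>lam. \<bar>real_of_int l\<bar>)"

lemma abs_sum_scale: "g > 0 \<Longrightarrow> abs_sum (map ((*) g) M) = g * abs_sum M"
  by (induction M) (auto simp: abs_sum_def abs_mult algebra_simps)

section \<open>One coefficient coprime to the gcd of the others\<close>

context
  fixes M :: "int list" and q g :: int
  assumes g: "g > 0" and cop: "coprime q g" and M: "Gcd (set M) = 1"
begin

abbreviation (input) "coeffs \<equiv> q # map ((*) g) M"

lemma nonzero_coeff: "\<exists>\<mu>\<in>set M. \<mu> \<noteq> 0"
  using M by (metis Gcd_0_iff singletonI subsetI zero_neq_one)

lemma dilate_sum_coeffs: "dilate_sum coeffs A = dilate q A + dilate g (dilate_sum M A)"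
  by (simp add: dilate_sum_scale)

lemma finite_piece: "finite A \<Longrightarrow> finite (dilate q (part g s A) + dilate_sum M A)"
  using g by (intro finite_set_plus) auto

text \<open>Modulo \<open>g\<close> only the summand from \<open>dilate q A\<close> matters, and
  multiplication by \<open>q\<close> permutes the classes. After division by \<open>g\<close>, the
  sums starting from class \<open>s\<close> form a translate of the piece shown, which keeps the
  whole of \<open>A\<close> in its second term.\<close>

lemma dilate_sum_decomposition:
  assumes "finite A"
  shows "(\<Sum>s\<in>residue_set g A. real (card (dilate q (part g s A) + dilate_sum M A))) \<le> card (dilate_sum coeffs A)"
proof -
  define e where "e s = (q * s + 0) mod g" for s
  define F where "F i = real (card (part g i (dilate q A) + dilate_sum M A))" for i
  have "card (dilate q (part g s A) + dilate_sum M A) \<le> card (part g (e s) (dilate q A) + dilate_sum M A)" for s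
  proof -
    let ?c = "(q * s + 0) div g"
    have "(+) ?c ` dilate q (part g s A) \<subseteq> part g (e s) (dilate q A)"
      using part_translate_subset[of 0 "[q]" A "dilate q A" s g]
      by (simp add: e_def set_zero[symmetric] del: set_zero)
    then have "(+) ?c ` (dilate q (part g s A) + dilate_sum M A) \<subseteq> part g (e s) (dilate q A) + dilate_sum M A"
      by (auto simp: set_plus_def image_subset_iff) (metis add.assoc)
    then show ?thesis
      using assms g by (metis card_mono card_translate finite_dilate finite_dilate_sum finite_part finite_set_plus)
  qed
  then have "(\<Sum>s\<in>residue_set g A. real (card (dilate q (part g s A) + dilate_sum M A))) \<le> (\<Sum>s\<in>residue_set g A. F (e s))"
    unfolding F_def by (intro sum_mono) simp
  also have "\<dots> \<le> (\<Sum>i\<in>{0..<g}. F i)"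
    using inj_on_subset[OF affine_residue_inj[OF cop, where z = 0] residue_set_subset] g
    by (intro sum_inj_residues_le) (auto simp: e_def F_def)
  also have "\<dots> = card (dilate_sum coeffs A)"
    using card_eq_sum_part_all[OF g, of "dilate_sum coeffs A"] part_plus_dilate[of g _ "dilate q A" 1 "dilate_sum M A"] assms
    unfolding dilate_sum_coeffs F_def by (simp add: finite_set_plus) (simp add: dilate_def)
  finally show ?thesis .
qed

text \<open>By \<open>dilate_sum_part\<close> the term \<open>g * y\<close>, shifted by
  \<open>sum_list M * s\<close>, lies in \<open>dilate_sum M A\<close>. So each piece contains a
  copy of the full sum of dilates for the smaller set.\<close>

lemma translate_dilate_sum_part_subset:
  "(+) (sum_list M * s) ` dilate_sum coeffs (part g s A) \<subseteq> dilate q (part g s A) + dilate_sum M A"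
proof (rule image_subsetI)
  fix x assume "x \<in> dilate_sum coeffs (part g s A)"
  then obtain b y where "b \<in> part g s A" "y \<in> dilate_sum M (part g s A)" "x = q * b + g * y"
    by (auto simp: dilate_sum_scale set_plus_def dilate_iff)
  moreover from this have "g * y + sum_list M * s \<in> dilate_sum M A" by (intro dilate_sum_part)
  ultimately show "sum_list M * s + x \<in> dilate q (part g s A) + dilate_sum M A"
    using plus_dilateI[of "g * y + sum_list M * s" "dilate_sum M A" b "part g s A" _ q] by (simp add: add_ac)
qed

lemma card_piece_ge_dilate_sum:
  "finite A \<Longrightarrow> card (dilate_sum coeffs (part g s A)) \<le> card (dilate q (part g s A) + dilate_sum M A)"
  using card_mono[OF finite_piece translate_dilate_sum_part_subset] by (simp only: card_translate)

lemma card_piece_ge: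
  assumes "finite A" "s \<in> residue_set g A"
  shows "card A \<le> card (dilate q (part g s A) + dilate_sum M A)"
proof -
  obtain \<mu> where "\<mu> \<in> set M" "\<mu> \<noteq> 0" using nonzero_coeff by blast
  then have "card A \<le> card (dilate_sum M A)" using assms card_dilate_sum_ge by blast
  also have "\<dots> \<le> card (dilate_sum M A + dilate q (part g s A))"
    using assms g by (intro card_le_set_plus) (auto simp: residue_set_def)
  finally show ?thesis by (simp add: add.commute)
qed

text \<open>As \<open>q\<close> is invertible modulo \<open>g\<close>, \<open>dilate q\<close> of
  the class misses a residue too. By \<open>extra_class\<close> the piece meets a residue avoided by
  the copy of the smaller sum, and varying one summand over a class of \<open>A\<close> puts
  \<open>card (part g t A)\<close> elements there.\<close>

lemma piece_gain:
  assumes "finite A" "primitive g A" "A \<noteq> {}" and s: "s \<in> residue_set g A" "residue_set g (part g s A) \<noteq> {0..<g}"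
  shows "\<exists>t\<in>residue_set g A. card (dilate_sum coeffs (part g s A)) + card (part g t A)
           \<le> card (dilate q (part g s A) + dilate_sum M A)"
proof -
  let ?B = "part g s A"
  have "residue_set g (dilate q ?B) \<noteq> {0..<g}"
  proof
    assume full: "residue_set g (dilate q ?B) = {0..<g}"
    have "i \<in> residue_set g ?B" if i: "i \<in> {0..<g}" for i
    proof -
      obtain b where b: "b \<in> ?B" "[q * b = q * i] (mod g)"
        using residue_set_full_residue[OF g full, of "q * i"] by (auto simp: dilate_iff)
      then have "[b = i] (mod g)" using cop by (simp add: cong_mult_lcancel)
      then show ?thesis using b i g by (auto simp: residue_set_iff cong_def)
    qed
    then show False using s(2) residue_set_subset by blast
  qed
  moreover have "dilate q ?B \<noteq> {}" using s by (auto simp: residue_set_def)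
  moreover have "primitive g (dilate_sum M A)" using assms M by (intro primitive_dilate_sum) auto
  ultimately obtain y x where yx: "y \<in> dilate q ?B" "x \<in> dilate_sum M A"
    and new: "\<And>y'. y' \<in> dilate q ?B \<Longrightarrow> \<not> [y + x = y' + sum_list M * s] (mod g)"
    using extra_class[OF g, of "dilate_sum M A" "dilate q ?B" "sum_list M * s"] by blast
  obtain \<mu> where \<mu>: "\<mu> \<in> set M" "\<mu> \<noteq> 0" using nonzero_coeff by blast
  obtain c a where c: "a \<in> A" "x = c + \<mu> * a" "\<And>b. b \<in> A \<Longrightarrow> c + \<mu> * b \<in> dilate_sum M A"
    using dilate_sum_replace[OF yx(2) \<mu>(1)] by blast
  define t where "t = a mod g"
  have t: "t \<in> residue_set g A" using c g by (auto simp: residue_set_iff t_def)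
  define P where "P = (+) (sum_list M * s) ` dilate_sum coeffs ?B"
  define Q where "Q = (\<lambda>b. y + (c + \<mu> * b)) ` {b \<in> A. [b = t] (mod g)}"
  have "card P + card Q \<le> card (dilate q ?B + dilate_sum M A)"
  proof (rule card_disjoint_subsets_le)
    show "finite (dilate q ?B + dilate_sum M A)" by (rule finite_piece) fact
    show "P \<subseteq> dilate q ?B + dilate_sum M A" unfolding P_def by (rule translate_dilate_sum_part_subset)
    show "Q \<subseteq> dilate q ?B + dilate_sum M A" unfolding Q_def using yx(1) c(3) by (auto intro!: set_plus_intro)
    show "P \<inter> Q = {}"
    proof (rule ccontr)
      assume "P \<inter> Q \<noteq> {}"
      then obtain x' where x': "x' \<in> P" "x' \<in> Q" by blast
      obtain y' z where z: "y' \<in> dilate q ?B" "x' = sum_list M * s + (y' + g * z)"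
        using x'(1) unfolding P_def dilate_sum_coeffs by (fastforce simp: set_plus_def dilate_iff[of _ g])
      obtain b where b: "b \<in> A" "[b = t] (mod g)" "x' = y + (c + \<mu> * b)"
        using x'(2) unfolding Q_def by auto
      have y': "y' \<in> dilate q ?B" "b \<in> A" "[b = t] (mod g)"
        "sum_list M * s + (y' + g * z) = y + (c + \<mu> * b)" using z b by auto
      have "[b = a] (mod g)" using y'(3) by (simp add: cong_def t_def)
      then have "[y + (c + \<mu> * b) = y + x] (mod g)" unfolding c(2) by (intro cong_add cong_mult) auto
      moreover have "[y + (c + \<mu> * b) = y' + sum_list M * s] (mod g)"
        unfolding y'(4)[symmetric] by (simp add: cong_iff_dvd_diff algebra_simps)
      ultimately show False using new[OF y'(1)] by (meson cong_sym cong_trans)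
    qed
  qed
  moreover have "card Q = card (part g t A)"
    unfolding Q_def card_part_class[OF g] using \<mu> by (intro card_image) (auto intro: inj_onI)
  moreover have "card P = card (dilate_sum coeffs ?B)" by (simp only: P_def card_translate)
  ultimately show ?thesis using t by auto
qed

text \<open>If \<open>A\<close> meets all \<open>g\<close> classes, each piece is
  \<open>dilate_sum M A\<close> enlarged by \<open>dilate q\<close> of one class. The first parts
  give \<open>g * abs_sum M\<close> of the slope, and the enlargements give
  \<open>\<bar>q\<bar>\<close>, because the class sizes add up to \<open>card A\<close>.\<close>

lemma dilate_sum_lower_bound_step:
  assumes CM: "CM \<ge> 0" "\<And>A. finite A \<Longrightarrow> A \<noteq> {} \<Longrightarrow> real (card (dilate_sum M A)) \<ge> abs_sum M * card A - CM"
  shows "\<exists>C::real. C \<ge> 0 \<and> (\<forall>A. finite A \<longrightarrow> A \<noteq> {} \<longrightarrow> real (card (dilate_sum coeffs A)) \<ge> abs_sum coeffs * card A - C)"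
proof -
  have total_lam: "abs_sum coeffs = \<bar>real_of_int q\<bar> + g * abs_sum M"
    using abs_sum_scale[OF g] by (simp add: abs_sum_def)
  have "gcd q (Gcd (set (map ((*) g) M))) = 1"
    using cop M g by (simp add: Gcd_mult_image coprime_iff_gcd_eq_1)
  then obtain C1 :: real where C1: "C1 \<ge> 0" and excess: "\<And>A Z. finite A \<Longrightarrow> A \<noteq> {} \<Longrightarrow> finite Z \<Longrightarrow>
      covers (map ((*) g) M) A Z \<Longrightarrow> excess Z q A \<ge> real_of_int \<bar>q\<bar> * card A - C1"
    using excess_lower_bound by metis
  define R where "R A v \<longleftrightarrow> A \<noteq> {} \<and> v = real (card (dilate_sum coeffs A))" for A v
  have "\<exists>C\<ge>0::real. \<forall>A v. finite A \<longrightarrow> R A v \<longrightarrow> v \<ge> abs_sum coeffs * card A - C"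
  proof (rule linear_bound_bootstrap[where R = R and N = g and ?C0.0 = "g * (C1 + CM)"])
    show "g > 0" by fact
    have "abs_sum M \<ge> 1"
    proof -
      obtain \<mu> where \<mu>: "\<mu> \<in> set M" "\<mu> \<noteq> 0" using nonzero_coeff by blast
      then have "1 \<le> \<bar>real_of_int \<mu>\<bar>" by linarith
      also have "\<dots> \<le> abs_sum M" unfolding abs_sum_def using \<mu>(1)
        by (intro member_le_sum_list) auto
      finally show ?thesis .
    qed
    then have "1 * 1 \<le> g * abs_sum M" using g by (intro mult_mono) auto
    then show "abs_sum coeffs \<ge> 1" unfolding total_lam by simp
    show "g * (C1 + CM) \<ge> 0" using g C1 CM(1) by simp
  next
    fix A v assume "R A v"
    then show "v \<ge> 0" by (simp add: R_def)
  next
    fix A v assume A: "R A v" "finite A" "residue_set g A = {0..<g}"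
    have ne: "A \<noteq> {}" and v: "v = card (dilate_sum coeffs A)" using A by (auto simp: R_def)
    have piece: "real (card (dilate q (part g s A) + dilate_sum M A))
        \<ge> card (dilate_sum M A) + \<bar>real_of_int q\<bar> * card (part g s A) - C1" if s: "s \<in> residue_set g A" for s
    proof -
      \<comment> \<open>The relative bound is used with \<open>dilate_sum M A\<close> as the large
        set \<open>Z\<close> and class \<open>s\<close> as the small one.\<close>
      have "covers (map ((*) g) M) (part g s A) (dilate_sum M A)"
        unfolding covers_def dilate_sum_scale using dilate_sum_part[of _ M g s A]
        by (intro exI[of _ "sum_list M * s"]) (auto simp: dilate_iff add.commute)
      then show ?thesis
        using excess[of "part g s A" "dilate_sum M A"] s A(2) g
        by (auto simp: residue_set_def excess_def add.commute)
    qed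
    have "(\<Sum>s\<in>residue_set g A. card (dilate_sum M A) + \<bar>real_of_int q\<bar> * card (part g s A) - C1) \<le> v"
      using order_trans[OF sum_mono[OF piece] dilate_sum_decomposition[OF A(2)]] unfolding v by simp
    moreover have "(\<Sum>s\<in>residue_set g A. card (dilate_sum M A) + \<bar>real_of_int q\<bar> * card (part g s A) - C1)
        = g * real (card (dilate_sum M A)) + \<bar>real_of_int q\<bar> * card A - g * C1"
      using g unfolding card_eq_sum_part[OF g A(2)] A(3)
      by (simp add: sum_subtractf sum.distrib sum_distrib_left)
    moreover have "g * (abs_sum M * card A - CM) \<le> g * real (card (dilate_sum M A))"
      using CM(2)[OF A(2) ne] g by (intro mult_left_mono) auto
    ultimately show "v \<ge> abs_sum coeffs * card A - g * (C1 + CM)"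
      unfolding total_lam by (simp add: algebra_simps)
  next
    fix A v d s assume A: "R A v" "finite A" "d > 1" "d dvd g" "\<forall>a\<in>A. a mod d = s"
    have "(\<lambda>y. d * y + sum_list coeffs * s) ` dilate_sum coeffs (part d s A) \<subseteq> dilate_sum coeffs A"
      using dilate_sum_part[of _ coeffs d s A] by blast
    then have "card ((\<lambda>y. d * y + sum_list coeffs * s) ` dilate_sum coeffs (part d s A)) \<le> card (dilate_sum coeffs A)"
      using A(2) by (intro card_mono finite_dilate_sum)
    moreover have "card ((\<lambda>y. d * y + sum_list coeffs * s) ` dilate_sum coeffs (part d s A)) = card (dilate_sum coeffs (part d s A))"
      using A(3) by (intro card_image) (auto intro: inj_onI)
    moreover have "part d s A \<noteq> {}" using A part_single_class[of d A s] by (auto simp: R_def)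
    ultimately show "\<exists>w\<le>v. R (part d s A) w" using A(1) by (auto simp: R_def)
  next
    fix A v assume A: "R A v" "finite A" "primitive g A"
    define f where "f s = real (card (dilate q (part g s A) + dilate_sum M A))" for s
    have "sum f (residue_set g A) \<le> v" using dilate_sum_decomposition[OF A(2)] A(1) by (simp add: R_def f_def)
    moreover have "f s \<ge> real (card A) - 1" if "s \<in> residue_set g A" for s
      using card_piece_ge[OF A(2) that] by (simp add: f_def)
    moreover have "real (card (dilate_sum coeffs (part g s A))) \<le> f s" for s
      using card_piece_ge_dilate_sum[OF A(2)] unfolding f_def by (simp only: of_nat_le_iff)
    moreover have "R (part g s A) (card (dilate_sum coeffs (part g s A)))" if "s \<in> residue_set g A" for s
      using that by (simp add: R_def residue_set_def)
    moreover have "residue_set g (part g s A) = {0..<g} \<or>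
        (\<exists>t\<in>residue_set g A. f s \<ge> real (card (dilate_sum coeffs (part g s A))) + card (part g t A))"
      if "s \<in> residue_set g A" for s
      using piece_gain[OF A(2,3) _ that] A(1) unfolding R_def f_def by (metis of_nat_add of_nat_le_iff)
    ultimately show "splits_with_gain R g A v"
      unfolding splits_with_gain_def
      by (intro exI[of _ f]) meson
  qed
  then obtain C :: real where C: "C \<ge> 0"
    "\<And>A v. finite A \<Longrightarrow> R A v \<Longrightarrow> v \<ge> abs_sum coeffs * card A - C" by blast
  have "real (card (dilate_sum coeffs A)) \<ge> abs_sum coeffs * card A - C" if "finite A" "A \<noteq> {}" for A
    using that by (intro C(2)) (auto simp: R_def)
  then show ?thesis using C(1) by blast
qed

end

text \<open>Split off the first coefficient and divide the others by their gcd \<open>g\<close>,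
  which restores coprimality for the induction. The empty list is excluded since its
  \<open>Gcd\<close> is 0.\<close>

lemma dilate_sum_lower_bound:
  assumes "Gcd (set lam) = 1"
  shows "\<exists>C::real. C \<ge> 0 \<and> (\<forall>A. finite A \<longrightarrow> A \<noteq> {} \<longrightarrow> real (card (dilate_sum lam A)) \<ge> abs_sum lam * card A - C)"
  using assms
proof (induction "length lam" arbitrary: lam)
  case (Suc n)
  then obtain q L where lam: "lam = q # L" by (cases lam) auto
  define g where "g = Gcd (set L)"
  have qg: "gcd q g = 1" using Suc.prems by (simp add: lam g_def)
  show ?case
  proof (cases "g = 0")
    \<comment> \<open>The other coefficients vanish, so \<open>q\<close> is 1 or -1 and the required
      slope is 1.\<close>
    case True
    then have zero: "l = 0" if "l \<in> set L" for l using that by (auto simp: g_def)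
    have "abs_sum lam = 1"
    proof -
      have "abs_sum L = 0" using zero unfolding abs_sum_def by (induction L) auto
      then show ?thesis using qg True by (simp add: abs_sum_def lam flip: of_int_abs)
    qed
    moreover have "card A \<le> card (dilate_sum lam A)" if "finite A" for A
      using card_dilate_sum_ge[OF that, of q lam] qg True by (auto simp: lam)
    ultimately show ?thesis by (intro exI[of _ 0]) auto
  next
    case False
    then have g: "g > 0" by (simp add: g_def order_less_le)
    define M where "M = map (\<lambda>l. l div g) L"
    have L: "L = map ((*) g) M"
      unfolding M_def by (simp add: comp_def) (intro map_idI[symmetric], simp add: g_def)
    have "set L = (*) g ` set M" using L by (metis set_map)
    then have "g * Gcd (set M) = g" using Gcd_mult_image[OF g, of "set M"] unfolding g_def by simp
    then have M: "Gcd (set M) = 1" using g by simp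
    have "n = length M" using Suc.hyps(2) by (simp add: lam M_def)
    from Suc.hyps(1)[OF this M] obtain CM :: real where "CM \<ge> 0"
      "\<And>A. finite A \<Longrightarrow> A \<noteq> {} \<Longrightarrow> real (card (dilate_sum M A)) \<ge> abs_sum M * card A - CM" by blast
    then show ?thesis
      using dilate_sum_lower_bound_step[OF g _ M, of q CM] qg unfolding lam L
      by (simp add: coprime_iff_gcd_eq_1)
  qed
qed simp

theorem theorem1:
  fixes lam :: "int list"
  assumes "length lam \<ge> 1"
    and "Gcd (set lam) = 1"
  shows "\<exists>C::real. C \<ge> 0 \<and> (\<forall>A :: int set. finite A \<longrightarrow>
           real (card (sumset_list (map (\<lambda>l. dilate l A) lam)))
             \<ge> real (\<Sum>l\<leftarrow>lam. nat \<bar>l\<bar>) * real (card A) - C)"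
proof -
  obtain C :: real where C: "C \<ge> 0"
    "\<And>A. finite A \<Longrightarrow> A \<noteq> {} \<Longrightarrow> real (card (dilate_sum lam A)) \<ge> abs_sum lam * card A - C"
    using dilate_sum_lower_bound[OF assms(2)] by blast
  have "real (\<Sum>l\<leftarrow>lam. nat \<bar>l\<bar>) = abs_sum lam"
    by (induction lam) (auto simp: abs_sum_def)
  then have "real (card (sumset_list (map (\<lambda>l. dilate l A) lam)))
      \<ge> real (\<Sum>l\<leftarrow>lam. nat \<bar>l\<bar>) * real (card A) - C" if "finite A" for A
    using C that by (cases "A = {}") (auto simp: dilate_sum_def)
  then show ?thesis using C(1) by blast
qed

end
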